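(* As $n\to\infty$, the threshold bias of the $(1:q)$ Budget $K_4$-Game on $K_n$ satisfies $$q_{K_4}^b(n)\le\left(5\cdot 2^{-9/5}e^{2/5}+o(1)\right)n^{2/5}.$$
   Context: The $(1:q)$ Budget $K_4$-Game on the complete graph $K_n$ is played by Maker and Breaker, who take alternate turns, with Maker beginning. In her turn, Maker claims one previously unclaimed edge of $K_n$. In his turn, Breaker may claim an arbitrary number (possibly zero) of previously unclaimed edges of $K_n$, subject to the condition that at the end of his turn the total number of edges claimed by Breaker so far is at most $q$ times the total number of edges claimed by Maker so far. Maker wins if at some point she has claimed all six edges of a copy of $K_4$ in $K_n$. Breaker wins if he manages to claim at least one edge of each copy of $K_4$ in $K_n$. The threshold bias $q_{K_4}^b(n)$ is the smallest non-negative integer $q$ such that Breaker has a winning strategy in this game. Here $e$ denotes Euler's number. *)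

theory Defs
  imports Complex_Main "HOL-Library.Landau_Symbols"
begin

type_synonym edge = "nat set"

definition complete_graph_on :: "nat set \<Rightarrow> edge set" where
  "complete_graph_on V = {e. e \<subseteq> V \<and> card e = 2}"

definition K4_copies :: "nat \<Rightarrow> edge set set" where
  "K4_copies n = {complete_graph_on S | S. S \<subseteq> {..<n} \<and> card S = 4}"

text \<open>A play is the list of its completed rounds in chronological order; a round consists of
  the edge claimed by Maker followed by the (possibly empty) set of edges claimed by Breaker.\<close>

type_synonym play = "(edge \<times> edge set) list"

definition maker_edges :: "play \<Rightarrow> edge set" where
  "maker_edges h = fst ` set h"

definition breaker_edges :: "play \<Rightarrow> edge set" where
  "breaker_edges h = \<Union> (snd ` set h)"

definition unclaimed :: "nat \<Rightarrow> play \<Rightarrow> edge set" where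
  "unclaimed n h = complete_graph_on {..<n} - (maker_edges h \<union> breaker_edges h)"

definition legal_response :: "nat \<Rightarrow> nat \<Rightarrow> play \<Rightarrow> edge \<Rightarrow> edge set \<Rightarrow> bool" where
  "legal_response q n h e F \<longleftrightarrow>
     F \<subseteq> unclaimed n h - {e} \<and>
     card (breaker_edges h \<union> F) \<le> q * card (insert e (maker_edges h))"

text \<open>A strategy of Breaker prescribes his response given the completed rounds so far and
  the edge just claimed by Maker.\<close>

type_synonym strategy = "play \<Rightarrow> edge \<Rightarrow> edge set"

inductive follows :: "nat \<Rightarrow> strategy \<Rightarrow> play \<Rightarrow> bool" for n \<sigma> where
  start: "follows n \<sigma> []"
| round: "follows n \<sigma> h \<Longrightarrow> e \<in> unclaimed n h \<Longrightarrow> follows n \<sigma> (h @ [(e, \<sigma> h e)])"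

definition breaker_wins :: "nat \<Rightarrow> play \<Rightarrow> bool" where
  "breaker_wins n h \<longleftrightarrow> (\<forall>C\<in>K4_copies n. C \<inter> breaker_edges h \<noteq> {})"

text \<open>The outcome is evaluated on finished plays, that is, when every edge has been claimed.
  Maker claims an edge in each round, so every play can be continued to a finished one, and as
  claims are permanent, Breaker wins a finished play iff at no point Maker owned a copy of
  \<open>K\<^sub>4\<close>.\<close>

definition winning_strategy :: "nat \<Rightarrow> nat \<Rightarrow> strategy \<Rightarrow> bool" where
  "winning_strategy q n \<sigma> \<longleftrightarrow>
     (\<forall>h. follows n \<sigma> h \<longrightarrow>
        (\<forall>e\<in>unclaimed n h. legal_response q n h e (\<sigma> h e)) \<and>
        (unclaimed n h = {} \<longrightarrow> breaker_wins n h))"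

definition threshold_bias :: "nat \<Rightarrow> nat" where
  "threshold_bias n = (LEAST q. \<exists>\<sigma>. winning_strategy q n \<sigma>)"

text \<open>The minimum is attained: with a large bias, Breaker claims all remaining edges in his
  first turn.\<close>

lemma winning_strategy_exists: "\<exists>q \<sigma>. winning_strategy q n \<sigma>"
proof -
  define E where "E = complete_graph_on {..<n}"
  define \<sigma> :: strategy where "\<sigma> = (\<lambda>h e. unclaimed n h - {e})"
  have finE: "finite E"
    unfolding E_def complete_graph_on_def by (rule finite_subset[of _ "Pow {..<n}"]) auto
  have shape: "h = [] \<or> (\<exists>e\<in>E. h = [(e, E - {e})])" if "follows n \<sigma> h" for h
    using that
    by induction (auto simp: \<sigma>_def E_def unclaimed_def maker_edges_def breaker_edges_def)
  have legal: "legal_response (card E) n h e (\<sigma> h e)"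
    if "follows n \<sigma> h" and "e \<in> unclaimed n h" for h e
  proof -
    have "h = []" "e \<in> E"
      using shape[OF that(1)] that(2)
      by (auto simp: E_def unclaimed_def maker_edges_def breaker_edges_def)
    then show ?thesis
      using finE
      by (auto simp: legal_response_def \<sigma>_def unclaimed_def maker_edges_def breaker_edges_def
          E_def intro!: card_mono)
  qed
  have two: "\<exists>a b. a \<in> C \<and> b \<in> C \<and> a \<noteq> b" and sub: "C \<subseteq> E" if C: "C \<in> K4_copies n" for C
  proof -
    obtain S where S: "C = complete_graph_on S" "S \<subseteq> {..<n}" "card S = 4"
      using C by (auto simp: K4_copies_def)
    then show "C \<subseteq> E" by (auto simp: E_def complete_graph_on_def)
    have "card S = Suc (Suc (Suc (Suc 0)))" using S(3) by simp
    then obtain x y z where "x \<in> S" "y \<in> S" "z \<in> S" "x \<noteq> y" "x \<noteq> z" "y \<noteq> z"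
      by (auto simp: card_Suc_eq)
    then have "{x, y} \<in> C" "{x, z} \<in> C" "{x, y} \<noteq> {x, z}"
      by (auto simp: S(1) complete_graph_on_def doubleton_eq_iff)
    then show "\<exists>a b. a \<in> C \<and> b \<in> C \<and> a \<noteq> b" by blast
  qed
  have "breaker_wins n h" if fol: "follows n \<sigma> h" and fin: "unclaimed n h = {}" for h
    unfolding breaker_wins_def
  proof
    fix C assume C: "C \<in> K4_copies n"
    obtain a b where ab: "a \<in> C" "b \<in> C" "a \<noteq> b" using two[OF C] by blast
    have "h \<noteq> []"
      using fin ab sub[OF C] by (auto simp: E_def unclaimed_def maker_edges_def breaker_edges_def)
    then obtain e where "h = [(e, E - {e})]" using shape[OF fol] by blast
    then show "C \<inter> breaker_edges h \<noteq> {}"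
      using ab sub[OF C] by (auto simp: breaker_edges_def)
  qed
  then show ?thesis using legal unfolding winning_strategy_def by blast
qed

end

theory Submission imports Defs "HOL-Real_Asymp.Real_Asymp" begin

text \<open>Breaker spends a bias \<open>q\<close> on Beck's potential strategy, which prevents every
  biclique formed by the two ends of an edge and \<open>s\<close> common neighbours; so common neighbourhoods
  in Maker's graph have fewer than \<open>s\<close> vertices. In addition he claims at once every edge \<open>xy\<close> that
  would complete a \<open>K\<^sub>4\<close> for Maker. The opposite edge \<open>uv\<close> of such a \<open>K\<^sub>4\<close>
  belongs to Maker, and \<open>x\<close>, \<open>y\<close> are common neighbours of \<open>u\<close> and \<open>v\<close>; so the budget
  pays for these claims with an additional bias of at most \<open>s\<^sup>2 / 2\<close>. With
  \<open>s = a n\<^bsup>1/5\<^esup>\<close> and \<open>q = b n\<^bsup>2/5\<^esup>\<close> the potential strategy works as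
  soon as \<open>a b\<^sup>2 > e\<close>, and minimising \<open>b + a\<^sup>2 / 2\<close> yields the constant.\<close>

section \<open>Beck's potential method for one claim of Maker against \<open>q\<close> of
  Breaker\<close>

definition potential :: "real \<Rightarrow> 'a set set \<Rightarrow> 'a set \<Rightarrow> 'a set \<Rightarrow> real" where
  "potential l \<F> M B = (\<Sum>A | A \<in> \<F> \<and> A \<inter> B = {}. (1 / l) ^ card (A - M))"

text \<open>The total weight of the surviving sets through \<open>e\<close>: the loss of potential if Breaker claims
  \<open>e\<close>, and, up to the factor \<open>l - 1\<close>, the gain if Maker does.\<close>

definition danger :: "real \<Rightarrow> 'a set set \<Rightarrow> 'a set \<Rightarrow> 'a set \<Rightarrow> 'a \<Rightarrow> real" where
  "danger l \<F> M B e = (\<Sum>A | A \<in> \<F> \<and> A \<inter> B = {} \<and> e \<in> A. (1 / l) ^ card (A - M))"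

lemma potential_antimono:
  assumes "finite \<F>" "l > 0" "B \<subseteq> B'"
  shows "potential l \<F> M B' \<le> potential l \<F> M B"
  unfolding potential_def using assms by (intro sum_mono2) auto

lemma danger_antimono:
  assumes "finite \<F>" "l > 0" "B \<subseteq> B'"
  shows "danger l \<F> M B' e \<le> danger l \<F> M B e"
  unfolding danger_def using assms by (intro sum_mono2) auto

lemma danger_le_potential:
  assumes "finite \<F>" "l > 0"
  shows "danger l \<F> M B e \<le> potential l \<F> M B"
  unfolding danger_def potential_def using assms by (intro sum_mono2) auto

lemma potential_split:
  assumes "finite \<F>"
  shows "potential l \<F> M B =
    danger l \<F> M B e + (\<Sum>A | A \<in> \<F> \<and> A \<inter> B = {} \<and> e \<notin> A. (1 / l) ^ card (A - M))"
proof -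
  have "{A. A \<in> \<F> \<and> A \<inter> B = {}} =
      {A. A \<in> \<F> \<and> A \<inter> B = {} \<and> e \<in> A} \<union> {A. A \<in> \<F> \<and> A \<inter> B = {} \<and> e \<notin> A}"
    by auto
  then show ?thesis
    unfolding potential_def danger_def using assms by (simp add: sum.union_disjoint disjoint_iff)
qed

lemma potential_insert_Breaker:
  assumes "finite \<F>"
  shows "potential l \<F> M (insert f B) = potential l \<F> M B - danger l \<F> M B f"
proof -
  have "{A. A \<in> \<F> \<and> A \<inter> insert f B = {}} = {A. A \<in> \<F> \<and> A \<inter> B = {} \<and> f \<notin> A}"
    by auto
  then show ?thesis
    using potential_split[OF assms, of l M B f] by (simp add: potential_def)
qed

text \<open>Maker's claim removes one missing element from each surviving set through
  \<open>e\<close>, so exactly these weights are multiplied by \<open>l\<close>.\<close>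

lemma potential_insert_Maker:
  assumes "finite \<F>" "\<And>A. A \<in> \<F> \<Longrightarrow> finite A" "l > 0" "e \<notin> M"
  shows "potential l \<F> (insert e M) B = potential l \<F> M B + (l - 1) * danger l \<F> M B e"
proof -
  have "(1 / l) ^ card (A - insert e M) = l * (1 / l) ^ card (A - M)" if "A \<in> \<F>" "e \<in> A" for A
  proof -
    have "card (A - M) = Suc (card (A - insert e M))"
      using that assms by (metis DiffI Diff_insert card_Suc_Diff1 finite_Diff)
    then show ?thesis using assms(3) by simp
  qed
  then have "danger l \<F> (insert e M) B e = l * danger l \<F> M B e"
    unfolding danger_def sum_distrib_left by (intro sum.cong) auto
  moreover have "A - insert e M = A - M" if "e \<notin> A" for A using that by auto
  ultimately show ?thesis
    unfolding potential_split[OF assms(1), of l _ B e] by (simp add: algebra_simps)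
qed

text \<open>Breaker repeatedly claims an element of greatest danger. Each claim lowers the potential
  by that danger, and dangers only decrease later, so every claim pays for one copy of the final
  danger of any remaining \<open>e\<close>.\<close>

lemma greedy_response:
  assumes "finite \<F>" "finite U" "l > 0"
  shows "\<exists>F. F \<subseteq> U \<and> card F \<le> k \<and> (\<forall>e\<in>U - F.
    potential l \<F> M (B \<union> F) + real k * danger l \<F> M (B \<union> F) e \<le> potential l \<F> M B)"
proof (induction k)
  case 0
  show ?case by (intro exI[of _ "{}"]) auto
next
  case (Suc k)
  then obtain F where F: "F \<subseteq> U" "card F \<le> k" and
    bound: "\<And>e. e \<in> U - F \<Longrightarrow>
      potential l \<F> M (B \<union> F) + real k * danger l \<F> M (B \<union> F) e \<le> potential l \<F> M B"
    by blast
  show ?case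
  proof (cases "U - F = {}")
    \<comment> \<open>No element is left to claim, so the bound is vacuous.\<close>
    case True
    then show ?thesis using F by (intro exI[of _ F]) auto
  next
    case False
    let ?w = "danger l \<F> M (B \<union> F)"
    obtain f where f: "f \<in> U - F" and max: "\<And>e. e \<in> U - F \<Longrightarrow> ?w e \<le> ?w f"
    proof -
      have "finite (?w ` (U - F))" "?w ` (U - F) \<noteq> {}" using assms(2) False by auto
      then have "Max (?w ` (U - F)) \<in> ?w ` (U - F)" by (rule Max_in)
      then obtain f where "f \<in> U - F" "Max (?w ` (U - F)) = ?w f" by auto
      moreover have "?w e \<le> Max (?w ` (U - F))" if "e \<in> U - F" for e
        using that assms(2) by (intro Max_ge) auto
      ultimately show ?thesis using that by metis
    qed
    have "potential l \<F> M (B \<union> insert f F) + real (Suc k) * danger l \<F> M (B \<union> insert f F) e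
        \<le> potential l \<F> M B" if e: "e \<in> U - insert f F" for e
    proof -
      have "danger l \<F> M (B \<union> insert f F) e \<le> ?w e"
        using assms by (intro danger_antimono) auto
      also have "\<dots> \<le> ?w f" using e by (intro max) auto
      finally have "real (Suc k) * danger l \<F> M (B \<union> insert f F) e \<le> real (Suc k) * ?w f"
        by (intro mult_left_mono) auto
      then show ?thesis
        using bound[OF f] potential_insert_Breaker[OF assms(1), of l M f "B \<union> F"]
        by (simp add: algebra_simps)
    qed
    moreover have "card (insert f F) \<le> Suc k"
      using F(2) f finite_subset[OF F(1) assms(2)] by simp
    ultimately show ?thesis using F(1) f by (intro exI[of _ "insert f F"]) auto
  qed
qed

text \<open>Greedy claims never let the potential grow over a Breaker turn followed by a Maker turn,
  and further claims by Breaker only help.\<close>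

lemma potential_response:
  assumes "finite \<F>" "\<And>A. A \<in> \<F> \<Longrightarrow> finite A" "finite U" "U \<inter> M = {}"
    and "potential (1 + real q) \<F> M B < 1"
  shows "\<exists>F. F \<subseteq> U \<and> card F \<le> q \<and> (\<forall>F' e. F \<subseteq> F' \<longrightarrow> e \<in> U - F' \<longrightarrow>
    potential (1 + real q) \<F> (insert e M) (B \<union> F') < 1)"
proof -
  let ?l = "1 + real q"
  obtain F where F: "F \<subseteq> U" "card F \<le> q" and
    bound: "\<And>e. e \<in> U - F \<Longrightarrow>
      potential ?l \<F> M (B \<union> F) + real q * danger ?l \<F> M (B \<union> F) e \<le> potential ?l \<F> M B"
    using greedy_response[OF assms(1,3), of ?l q M B] by auto
  have "potential ?l \<F> (insert e M) (B \<union> F') < 1" if "F \<subseteq> F'" "e \<in> U - F'" for F' e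
  proof -
    have "potential ?l \<F> (insert e M) (B \<union> F') \<le> potential ?l \<F> (insert e M) (B \<union> F)"
      using assms that by (intro potential_antimono) auto
    \<comment> \<open>For \<open>l = 1 + q\<close> the gain factor \<open>l - 1\<close> equals
      \<open>q\<close>, the number of dangers that the greedy claims have paid for.\<close>
    also have "\<dots> = potential ?l \<F> M (B \<union> F) + real q * danger ?l \<F> M (B \<union> F) e"
      using assms that by (subst potential_insert_Maker) auto
    also have "\<dots> \<le> potential ?l \<F> M B" using that by (intro bound) auto
    finally show ?thesis using assms(5) by simp
  qed
  then show ?thesis using F by blast
qed

text \<open>A surviving set owned by Maker would contribute weight 1 by itself.\<close>

lemma potential_full:
  assumes "finite \<F>" "l > 0" "potential l \<F> M B < 1" "A \<in> \<F>" "A \<inter> B = {}"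
  shows "\<not> A \<subseteq> M"
proof
  assume "A \<subseteq> M"
  then have "card (A - M) = 0" by (metis Diff_eq_empty_iff card.empty)
  then have "1 = (1 / l) ^ card (A - M)" by simp
  also have "\<dots> \<le> potential l \<F> M B"
    unfolding potential_def using assms
    by (intro member_le_sum[where f = "\<lambda>A. (1 / l) ^ card (A - M)"]) auto
  finally show False using assms(3) by simp
qed

section \<open>Bicliques, common neighbourhoods and threats\<close>

lemma finite_complete_graph_on: "finite V \<Longrightarrow> finite (complete_graph_on V)"
  unfolding complete_graph_on_def by (rule finite_subset[of _ "Pow V"]) auto

lemma card_complete_graph_on: "finite V \<Longrightarrow> card (complete_graph_on V) = card V choose 2"
  unfolding complete_graph_on_def by (rule n_subsets)

lemma K4_copies_subset: "C \<in> K4_copies n \<Longrightarrow> C \<subseteq> complete_graph_on {..<n}"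
  by (auto simp: K4_copies_def complete_graph_on_def)

definition join_edges :: "nat set \<Rightarrow> nat set \<Rightarrow> edge set" where
  "join_edges V W = (\<lambda>(u, w). {u, w}) ` (V \<times> W)"

lemma card_join_edges:
  assumes "V \<inter> W = {}"
  shows "card (join_edges V W) = card V * card W"
proof -
  have "inj_on (\<lambda>(u, w). {u, w}) (V \<times> W)"
    using assms by (auto simp: inj_on_def doubleton_eq_iff)
  then show ?thesis unfolding join_edges_def by (simp add: card_image card_cartesian_product)
qed

text \<open>These are the copies of \<open>K_{2,s}\<close> in \<open>K_n\<close>. The edge
  \<open>e\<close> only names the side of size two and is not itself a member of the set, whence the
  size \<open>2 * s\<close>.\<close>

definition bicliques :: "nat \<Rightarrow> nat \<Rightarrow> edge set set" where
  "bicliques n s = {join_edges e S | e S. e \<in> complete_graph_on {..<n} \<and> S \<subseteq> {..<n} \<and>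
     card S = s \<and> e \<inter> S = {}}"

lemma bicliques_subset_image:
  "bicliques n s \<subseteq> (\<lambda>(e, S). join_edges e S) `
     (complete_graph_on {..<n} \<times> {S. S \<subseteq> {..<n} \<and> card S = s})"
  unfolding bicliques_def by auto

lemma finite_bicliques: "finite (bicliques n s)"
  by (rule finite_subset[OF bicliques_subset_image])
    (auto intro!: finite_imageI finite_complete_graph_on)

lemma card_bicliques: "card (bicliques n s) \<le> (n choose 2) * (n choose s)"
proof -
  have "card (bicliques n s) \<le> card (complete_graph_on {..<n} \<times> {S. S \<subseteq> {..<n} \<and> card S = s})"
    by (rule surj_card_le[OF _ bicliques_subset_image]) (auto intro!: finite_complete_graph_on)
  then show ?thesis
    using card_complete_graph_on[of "{..<n}"]
    by (simp add: card_cartesian_product n_subsets)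
qed

lemma card_in_bicliques:
  assumes "A \<in> bicliques n s"
  shows "card A = 2 * s"
  using assms by (auto simp: bicliques_def card_join_edges complete_graph_on_def)

lemma finite_in_bicliques:
  assumes "A \<in> bicliques n s"
  shows "finite A"
  using assms by (auto simp: bicliques_def join_edges_def complete_graph_on_def
      intro!: finite_imageI finite_cartesian_product intro: finite_subset[of _ "{..<n}"])

definition common_nbrs :: "edge set \<Rightarrow> edge \<Rightarrow> nat set" where
  "common_nbrs M e = {w. w \<notin> e \<and> (\<forall>u\<in>e. {u, w} \<in> M)}"

text \<open>The edge \<open>f\<close> may already be claimed, even by Maker. Hence, for disjoint
  \<open>M\<close> and \<open>B\<close>, \<open>threats n M \<subseteq> B\<close> also says that
  Maker has no \<open>K4\<close>.\<close>

definition threats :: "nat \<Rightarrow> edge set \<Rightarrow> edge set" where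
  "threats n M = {f. \<exists>C\<in>K4_copies n. f \<in> C \<and> C - {f} \<subseteq> M}"

lemma threats_mono: "M \<subseteq> M' \<Longrightarrow> threats n M \<subseteq> threats n M'"
  unfolding threats_def by blast

lemma threats_subset: "threats n M \<subseteq> complete_graph_on {..<n}"
  using K4_copies_subset unfolding threats_def by blast

text \<open>Charging each threat to the opposite edge of its \<open>K4\<close> makes the count of
  threats linear in \<open>card M\<close>, as the budget requires.\<close>

lemma threats_subset_common_nbrs: "threats n M \<subseteq> (\<Union>e\<in>M. complete_graph_on (common_nbrs M e))"
proof
  fix f assume "f \<in> threats n M"
  then obtain S where S: "card S = 4" "f \<in> complete_graph_on S" "complete_graph_on S - {f} \<subseteq> M"
    by (auto simp: threats_def K4_copies_def)
  then have f: "f \<subseteq> S" "card f = 2" by (auto simp: complete_graph_on_def)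
  have "finite S" using S(1) by (metis card.infinite zero_neq_numeral)
  then have "card (S - f) = 2" using f S(1) by (simp add: card_Diff_subset finite_subset)
  \<comment> \<open>Only \<open>f\<close> may be missing from Maker's graph, so the opposite edge is
    hers.\<close>
  moreover have "S - f \<noteq> f"
    using f(2) by (metis Diff_disjoint Int_absorb card.empty zero_neq_numeral)
  ultimately have opp: "S - f \<in> M" using S(3) by (auto simp: complete_graph_on_def)
  have "{u, w} \<in> M" if "u \<in> S - f" "w \<in> f" for u w
  proof -
    have "{u, w} \<in> complete_graph_on S" using that f by (auto simp: complete_graph_on_def card_2_iff)
    moreover have "{u, w} \<noteq> f" using that by auto
    ultimately show ?thesis using S(3) by blast
  qed
  then have "f \<in> complete_graph_on (common_nbrs M (S - f))"
    using f by (auto simp: complete_graph_on_def common_nbrs_def)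
  then show "f \<in> (\<Union>e\<in>M. complete_graph_on (common_nbrs M e))" using opp by blast
qed

lemma card_common_nbrs_less:
  assumes M: "M \<subseteq> complete_graph_on {..<n}" and e: "e \<in> complete_graph_on {..<n}"
    and free: "\<And>A. A \<in> bicliques n s \<Longrightarrow> \<not> A \<subseteq> M"
  shows "finite (common_nbrs M e)" "card (common_nbrs M e) < s"
proof -
  have "e \<noteq> {}" using e by (auto simp: complete_graph_on_def)
  then have sub: "common_nbrs M e \<subseteq> {..<n}"
    using M by (auto simp: common_nbrs_def complete_graph_on_def)
  then show "finite (common_nbrs M e)" by (rule finite_subset) simp
  show "card (common_nbrs M e) < s"
  proof (rule ccontr)
    assume "\<not> card (common_nbrs M e) < s"
    then obtain S where S: "S \<subseteq> common_nbrs M e" "card S = s"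
      by (meson not_less obtain_subset_with_card_n)
    have "e \<inter> S = {}" using S(1) by (auto simp: common_nbrs_def)
    then have "join_edges e S \<in> bicliques n s"
      using e S sub unfolding bicliques_def by blast
    moreover have "join_edges e S \<subseteq> M" using S(1) by (auto simp: join_edges_def common_nbrs_def)
    ultimately show False using free by blast
  qed
qed

text \<open>The factor is the extra bias for blocking: each Maker edge is charged for the pairs
  among its at most \<open>s - 1\<close> common neighbours.\<close>

lemma card_threats:
  assumes M: "M \<subseteq> complete_graph_on {..<n}"
    and free: "\<And>A. A \<in> bicliques n s \<Longrightarrow> \<not> A \<subseteq> M"
  shows "card (threats n M) \<le> ((s - 1) choose 2) * card M"
proof -
  have finM: "finite M" using M finite_complete_graph_on finite_subset by blast
  have nbrs: "finite (common_nbrs M e)" "card (common_nbrs M e) < s" if "e \<in> M" for e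
    using card_common_nbrs_less[OF M _ free, of e] that M by auto
  have "card (threats n M) \<le> card (\<Union>e\<in>M. complete_graph_on (common_nbrs M e))"
    using finM nbrs by (intro card_mono threats_subset_common_nbrs)
      (auto intro: finite_complete_graph_on)
  also have "\<dots> \<le> (\<Sum>e\<in>M. card (complete_graph_on (common_nbrs M e)))"
    by (rule card_UN_le[OF finM])
  also have "\<dots> \<le> (\<Sum>e\<in>M. (s - 1) choose 2)"
  proof (rule sum_mono)
    fix e assume "e \<in> M"
    then show "card (complete_graph_on (common_nbrs M e)) \<le> (s - 1) choose 2"
      using nbrs[of e] by (simp add: card_complete_graph_on binomial_right_mono)
  qed
  finally show ?thesis by (simp add: mult.commute)
qed

section \<open>The position invariant and Breaker's strategy\<close>

text \<open>Describes positions with Maker to move. The potential is bounded for every possible next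
  edge because the argument needs a value below 1 just after her move. \<open>P\<close> collects the
  claims of the potential strategy, paid for by \<open>q\<close> alone; all other claims are threats
  and are counted separately.\<close>

definition position_inv :: "nat \<Rightarrow> nat \<Rightarrow> nat \<Rightarrow> edge set \<Rightarrow> edge set \<Rightarrow> bool" where
  "position_inv n s q M B \<longleftrightarrow>
     M \<subseteq> complete_graph_on {..<n} \<and> B \<subseteq> complete_graph_on {..<n} \<and> M \<inter> B = {} \<and>
     (\<forall>e\<in>complete_graph_on {..<n} - (M \<union> B).
        potential (1 + real q) (bicliques n s) (insert e M) B < 1) \<and>
     threats n M \<subseteq> B \<and>
     (\<exists>P. B \<subseteq> P \<union> threats n M \<and> finite P \<and> card P \<le> q * card M)"

text \<open>The extra factor \<open>1 + q\<close> in the hypothesis covers Maker's opening move: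
  since danger is at most the potential, that move multiplies the potential by at most
  \<open>1 + q\<close>.\<close>

lemma position_inv_start:
  assumes "(n choose 2) * (n choose s) * (1 + q) < (1 + q) ^ (2 * s)"
  shows "position_inv n s q {} {}"
proof -
  let ?l = "1 + real q"
  have "(\<Sum>A\<in>bicliques n s. (1 / ?l) ^ card A) = card (bicliques n s) * (1 / ?l) ^ (2 * s)"
    by (simp add: card_in_bicliques)
  then have pot: "potential ?l (bicliques n s) {} {} = card (bicliques n s) / ?l ^ (2 * s)"
    by (simp add: potential_def power_one_over)
  have "card (bicliques n s) * (1 + q) < (1 + q) ^ (2 * s)"
    using assms card_bicliques[of n s] by (meson le_less_trans mult_le_mono1)
  then have "real (card (bicliques n s) * (1 + q)) < real ((1 + q) ^ (2 * s))"
    by (simp only: of_nat_less_iff)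
  then have small: "?l * potential ?l (bicliques n s) {} {} < 1"
    unfolding pot by (simp add: field_simps)
  have "potential ?l (bicliques n s) (insert e {}) {} < 1" for e
  proof -
    have "potential ?l (bicliques n s) (insert e {}) {} =
      potential ?l (bicliques n s) {} {} + real q * danger ?l (bicliques n s) {} {} e"
      by (subst potential_insert_Maker) (auto simp: finite_bicliques finite_in_bicliques)
    also have "\<dots> \<le> potential ?l (bicliques n s) {} {} + real q * potential ?l (bicliques n s) {} {}"
      by (intro add_left_mono mult_left_mono danger_le_potential) (auto simp: finite_bicliques)
    finally show ?thesis using small by (simp add: algebra_simps)
  qed
  moreover have "threats n {} = {}"
    using threats_subset_common_nbrs[of n "{}"] by auto
  ultimately show ?thesis by (auto simp: position_inv_def)
qed

lemma position_inv_response: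
  assumes inv: "position_inv n s q M B" and e: "e \<in> complete_graph_on {..<n} - (M \<union> B)"
  shows "\<exists>F \<subseteq> complete_graph_on {..<n} - (insert e M \<union> B).
    card (B \<union> F) \<le> (q + ((s - 1) choose 2)) * card (insert e M) \<and>
    position_inv n s q (insert e M) (B \<union> F)"
proof -
  let ?E = "complete_graph_on {..<n}" and ?M = "insert e M"
  let ?U = "?E - (?M \<union> B)" and ?l = "1 + real q"
  have finE: "finite ?E" by (simp add: finite_complete_graph_on)
  have sub: "M \<subseteq> ?E" "B \<subseteq> ?E" "M \<inter> B = {}" and thr: "threats n M \<subseteq> B"
    and pot: "potential ?l (bicliques n s) ?M B < 1"
    using inv e by (auto simp: position_inv_def)
  obtain P where P: "B \<subseteq> P \<union> threats n M" "finite P" "card P \<le> q * card M"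
    using inv by (auto simp: position_inv_def)
  obtain F1 where F1: "F1 \<subseteq> ?U" "card F1 \<le> q" and keep: "\<And>F' d. F1 \<subseteq> F' \<Longrightarrow> d \<in> ?U - F' \<Longrightarrow>
      potential ?l (bicliques n s) (insert d ?M) (B \<union> F') < 1"
  proof -
    have "\<exists>F\<subseteq>?U. card F \<le> q \<and> (\<forall>F' d. F \<subseteq> F' \<longrightarrow> d \<in> ?U - F' \<longrightarrow>
      potential ?l (bicliques n s) (insert d ?M) (B \<union> F') < 1)"
      by (rule potential_response) (use pot finE in \<open>auto simp: finite_bicliques finite_in_bicliques\<close>)
    then show ?thesis using that by blast
  qed
  \<comment> \<open>The greedy reply together with all threats still unclaimed; the additional
    claims cannot raise the potential.\<close>
  define F where "F = F1 \<union> (threats n ?M - (?M \<union> B))"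
  have F: "F \<subseteq> ?U" using F1(1) threats_subset[of n ?M] by (auto simp: F_def)
  have cardM: "card ?M = Suc (card M)"
    using e sub(1) finE by (metis DiffD2 UnI1 card_insert_disjoint finite_subset)
  have "finite F1" using F1(1) finE by (meson finite_Diff finite_subset)
  then have P': "finite (P \<union> F1)" "card (P \<union> F1) \<le> q * card ?M"
    using P(2,3) F1(2) card_Un_le[of P F1] cardM by auto
  \<comment> \<open>Threats blocked in earlier rounds are still threats of \<open>?M\<close>, so a
    single count of \<open>threats n ?M\<close> bounds all blocking claims so far.\<close>
  have cover: "B \<union> F \<subseteq> (P \<union> F1) \<union> threats n ?M"
    using P(1) threats_mono[of M ?M n] by (auto simp: F_def)
  have sub': "?M \<subseteq> ?E" "B \<union> F \<subseteq> ?E" "?M \<inter> (B \<union> F) = {}"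
    using sub e F by auto
  \<comment> \<open>Bicliques are excluded already before Breaker replies, so the threats he has to
    block now are few enough.\<close>
  have "\<not> A \<subseteq> ?M" if "A \<in> bicliques n s" for A
  proof
    assume A: "A \<subseteq> ?M"
    have "A \<inter> B = {}" using A sub(3) e by blast
    then show False using potential_full[OF finite_bicliques _ pot that] A by simp
  qed
  then have "card (threats n ?M) \<le> ((s - 1) choose 2) * card ?M"
    by (intro card_threats sub'(1))
  moreover have "card (B \<union> F) \<le> card (P \<union> F1) + card (threats n ?M)"
    using card_mono[OF _ cover] card_Un_le[of "P \<union> F1" "threats n ?M"] P'(1)
      finite_subset[OF threats_subset finE, of ?M] by auto
  ultimately have budget: "card (B \<union> F) \<le> (q + ((s - 1) choose 2)) * card ?M"
    using P'(2) by (simp add: algebra_simps)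
  have "threats n ?M \<subseteq> B \<union> F"
  proof
    fix f assume f: "f \<in> threats n ?M"
    show "f \<in> B \<union> F"
    proof (cases "f \<in> ?M")
      case False
      then show ?thesis using f by (auto simp: F_def)
    next
      \<comment> \<open>Now Maker would own the whole \<open>K4\<close>. If it contains
        \<open>e\<close>, then \<open>e\<close> was a threat before her move and already belonged to
        Breaker; otherwise \<open>f\<close> was a threat before her move.\<close>
      case True
      then obtain C where C: "C \<in> K4_copies n" "f \<in> C" "C \<subseteq> ?M"
        using f by (auto simp: threats_def)
      show ?thesis
      proof (cases "e \<in> C")
        case True
        then have "e \<in> threats n M" using C by (auto simp: threats_def)
        then show ?thesis using thr e by blast
      next
        case False
        then have "f \<in> threats n M" using C by (auto simp: threats_def)
        then show ?thesis using thr by blast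
      qed
    qed
  qed
  moreover have "potential ?l (bicliques n s) (insert d ?M) (B \<union> F) < 1"
    if "d \<in> ?E - (?M \<union> (B \<union> F))" for d
    using that by (intro keep) (auto simp: F_def)
  ultimately have "position_inv n s q ?M (B \<union> F)"
    unfolding position_inv_def using sub' P' cover by blast
  then show ?thesis using F budget by blast
qed

text \<open>Every edge of a \<open>K4\<close> owned by Maker is a threat, hence would belong to
  Breaker too.\<close>

lemma position_inv_K4:
  assumes "position_inv n s q M B" "C \<in> K4_copies n"
  shows "\<not> C \<subseteq> M"
proof
  assume "C \<subseteq> M"
  obtain S where S: "C = complete_graph_on S" "card S = 4"
    using assms(2) by (auto simp: K4_copies_def)
  have "finite S" using S(2) by (metis card.infinite zero_neq_numeral)
  then have "card C = 4 choose 2" using S by (simp add: card_complete_graph_on)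
  then have "C \<noteq> {}" by (auto simp: numeral_eq_Suc)
  then obtain f where "f \<in> C" by blast
  then have "f \<in> threats n M" using assms(2) \<open>C \<subseteq> M\<close> by (auto simp: threats_def)
  then show False using assms(1) \<open>f \<in> C\<close> \<open>C \<subseteq> M\<close> by (auto simp: position_inv_def)
qed

lemma winning_strategy_criterion:
  assumes "(n choose 2) * (n choose s) * (1 + q) < (1 + q) ^ (2 * s)"
  shows "\<exists>\<sigma>. winning_strategy (q + ((s - 1) choose 2)) n \<sigma>"
proof -
  define good where "good = (\<lambda>h e F. F \<subseteq> unclaimed n h - {e} \<and>
    card (breaker_edges h \<union> F) \<le> (q + ((s - 1) choose 2)) * card (insert e (maker_edges h)) \<and>
    position_inv n s q (insert e (maker_edges h)) (breaker_edges h \<union> F))"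
  \<comment> \<open>The choice is arbitrary where no good reply exists; plays that follow
    \<open>\<sigma>\<close> keep the invariant and never get there.\<close>
  define \<sigma> :: strategy where "\<sigma> = (\<lambda>h e. SOME F. good h e F)"
  have good: "good h e (\<sigma> h e)"
    if "position_inv n s q (maker_edges h) (breaker_edges h)" "e \<in> unclaimed n h" for h e
  proof -
    have "\<exists>F. good h e F"
      using position_inv_response[OF that(1), of e] that(2) unfolding good_def unclaimed_def
      by blast
    then show ?thesis unfolding \<sigma>_def by (rule someI_ex)
  qed
  have inv: "position_inv n s q (maker_edges h) (breaker_edges h)" if "follows n \<sigma> h" for h
    using that
  proof induction
    case start
    then show ?case
      using position_inv_start[OF assms] by (simp add: maker_edges_def breaker_edges_def)
  next
    case (round h e)
    then show ?case
      using good[of h e] by (simp add: good_def maker_edges_def breaker_edges_def Un_commute)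
  qed
  have "breaker_wins n h" if h: "follows n \<sigma> h" and fin: "unclaimed n h = {}" for h
    unfolding breaker_wins_def
  proof
    fix C assume C: "C \<in> K4_copies n"
    then show "C \<inter> breaker_edges h \<noteq> {}"
      using position_inv_K4[OF inv[OF h] C] K4_copies_subset[OF C] fin
      unfolding unclaimed_def by blast
  qed
  moreover have "legal_response (q + ((s - 1) choose 2)) n h e (\<sigma> h e)"
    if "follows n \<sigma> h" "e \<in> unclaimed n h" for h e
    using good[OF inv[OF that(1)] that(2)] by (simp add: good_def legal_response_def)
  ultimately show ?thesis unfolding winning_strategy_def by blast
qed

section \<open>Asymptotics of the criterion and of the threshold\<close>

text \<open>The term of index \<open>s\<close> in the exponential series is at most the whole
  sum.\<close>

lemma power_self_le_exp_fact: "real s ^ s \<le> exp (real s) * fact s"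
proof -
  have sums: "(\<lambda>k. real s ^ k /\<^sub>R fact k) sums exp (real s)" by (rule exp_converges)
  have "(\<Sum>k\<in>{s}. real s ^ k /\<^sub>R fact k) \<le> (\<Sum>k. real s ^ k /\<^sub>R fact k)"
    using sums by (intro sum_le_suminf) (auto simp: sums_iff)
  then have "real s ^ s / fact s \<le> exp (real s)"
    using sums by (simp add: sums_iff field_simps)
  then show ?thesis by (simp add: field_simps)
qed

lemma choose_le_exp_power:
  assumes "s > 0"
  shows "real (n choose s) \<le> (exp 1 * real n / real s) ^ s"
proof -
  have "real (n choose s) * real s ^ s \<le> real (n choose s) * (exp (real s) * fact s)"
    by (intro mult_left_mono power_self_le_exp_fact) auto
  also have "\<dots> = exp 1 ^ s * real ((n choose s) * fact s)"
    by (simp add: exp_of_nat_mult [symmetric])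
  also have "(n choose s) * fact s \<le> n ^ s"
    by (rule binomial_fact_pow)
  finally show ?thesis
    using assms by (simp add: power_divide power_mult_distrib field_simps)
qed

lemma real_choose_2_le: "real (m choose 2) \<le> (real m)\<^sup>2 / 2"
proof -
  have "2 * (m choose 2) = m * (m - 1)"
    by (subst choose_two) (rule dvd_mult_div_cancel, cases m, auto)
  also have "\<dots> \<le> m * m" by simp
  finally have "2 * (m choose 2) \<le> m * m" .
  then have "real (2 * (m choose 2)) \<le> real (m * m)" by (simp only: of_nat_le_iff)
  then show ?thesis by (simp add: power2_eq_square)
qed

text \<open>With \<open>r = e / (a * b^2) < 1\<close>, the quotient of \<open>n choose s\<close> by
  \<open>(1 + q)^(2 * s)\<close> is at most \<open>r^s\<close>. This decays exponentially in
  \<open>n^(1/5)\<close> and beats the remaining polynomial factors.\<close>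

lemma eventually_criterion:
  fixes a b :: real
  assumes "a > 0" "b > 0" "exp 1 < a * b\<^sup>2"
  defines "s \<equiv> \<lambda>n. nat \<lceil>a * real n powr (1 / 5)\<rceil>" and "q \<equiv> \<lambda>n. nat \<lceil>b * real n powr (2 / 5)\<rceil>"
  shows "\<forall>\<^sub>F n in sequentially.
    (n choose 2) * (n choose s n) * (1 + q n) < (1 + q n) ^ (2 * s n)"
proof -
  define r where "r = exp 1 / (a * b\<^sup>2)"
  have r: "0 < r" "r < 1" using assms by (auto simp: r_def)
  define k where "k = - ln r"
  have "k > 0" using r by (simp add: k_def)
  \<comment> \<open>Here \<open>n^2\<close> bounds \<open>n choose 2\<close>, the second factor
    bounds \<open>1 + q n\<close> including its rounding, and the exponential bounds
    \<open>r ^ s n\<close>.\<close>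
  then have "\<forall>\<^sub>F n in sequentially.
      real n ^ 2 * (b * real n powr (2 / 5) + 2) * exp (- k * (a * real n powr (1 / 5))) < 1"
    using assms(1,2) by real_asymp
  then show ?thesis
    using eventually_gt_at_top[of 0]
  proof eventually_elim
    case (elim n)
    let ?x = "real n powr (1 / 5)"
    have x: "?x > 0" using elim by simp
    have x2: "real n powr (2 / 5) = ?x\<^sup>2" and x5: "real n = ?x ^ 5"
      using elim by (simp_all add: powr_power)
    have s: "a * ?x \<le> real (s n)" by (simp add: s_def real_nat_ceiling_ge)
    then have s0: "s n > 0" using x assms(1) by (metis gr0I mult_pos_pos not_less of_nat_0)
    have q: "b * ?x\<^sup>2 \<le> real (q n)" using x2 by (simp add: q_def real_nat_ceiling_ge)
    have q': "real (q n) \<le> b * ?x\<^sup>2 + 1"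
      unfolding q_def x2 using assms(2) by (simp add: of_nat_nat) 
    have "(exp 1 * real n / real (s n)) \<le> exp 1 * real n / (a * ?x)"
      using s x assms(1) s0 by (intro divide_left_mono) auto
    also have "\<dots> = r * (b * ?x\<^sup>2)\<^sup>2"
      unfolding r_def using x assms by (subst x5) (simp add: field_simps power2_eq_square eval_nat_numeral)
    also have "\<dots> \<le> r * (1 + real (q n))\<^sup>2"
      using q r x assms(2) by (intro mult_left_mono power_mono) auto
    finally have base: "exp 1 * real n / real (s n) \<le> r * (1 + real (q n))\<^sup>2" .
    have "real (n choose s n) \<le> (exp 1 * real n / real (s n)) ^ s n"
      by (rule choose_le_exp_power[OF s0])
    also have "\<dots> \<le> (r * (1 + real (q n))\<^sup>2) ^ s n"
      by (intro power_mono base) auto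
    also have "\<dots> = r ^ s n * (1 + real (q n)) ^ (2 * s n)"
      by (simp add: power_mult_distrib power_mult)
    also have "r ^ s n = exp (- k * real (s n))"
      using r by (simp add: k_def exp_of_nat2_mult)
    also have "\<dots> \<le> exp (- k * (a * ?x))"
      using s \<open>k > 0\<close> by simp
    finally have choose: "real (n choose s n) \<le> exp (- k * (a * ?x)) * (1 + real (q n)) ^ (2 * s n)"
      by (simp add: mult_right_mono)
    have "real (n choose 2) \<le> real n ^ 2"
      by (rule order_trans[OF real_choose_2_le]) simp
    then have "real (n choose 2) * real (n choose s n) * (1 + real (q n)) \<le>
        real n ^ 2 * (exp (- k * (a * ?x)) * (1 + real (q n)) ^ (2 * s n)) * (b * ?x\<^sup>2 + 2)"
      using choose q' by (intro mult_mono) auto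
    also have "\<dots> = (real n ^ 2 * (b * ?x\<^sup>2 + 2) * exp (- k * (a * ?x))) * (1 + real (q n)) ^ (2 * s n)"
      by (simp add: algebra_simps)
    also have "\<dots> < 1 * (1 + real (q n)) ^ (2 * s n)"
      using elim(1) unfolding x2 by (intro mult_strict_right_mono) auto
    finally have "real ((n choose 2) * (n choose s n) * (1 + q n)) < real ((1 + q n) ^ (2 * s n))"
      by (simp only: of_nat_mult of_nat_add of_nat_power of_nat_1 mult_1)
    then show ?case by (simp only: of_nat_less_iff)
  qed
qed

text \<open>The two biases contribute \<open>4c/5\<close> for the potential strategy and
  \<open>a^2 / 2 = c/5\<close> for the threats. One half of \<open>\<delta>\<close> makes the
  inequality \<open>e < a * b^2\<close> strict, the other absorbs the rounding of
  \<open>q\<close>.\<close>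

lemma eventually_threshold_bias_le:
  fixes c \<delta> :: real
  assumes c: "c = 5 * 2 powr (- 9 / 5) * exp 1 powr (2 / 5)" and "\<delta> > 0"
  shows "\<forall>\<^sub>F n in sequentially. real (threshold_bias n) \<le> (c + \<delta>) * real n powr (2 / 5)"
proof -
  \<comment> \<open>The values minimising \<open>b + a\<^sup>2 / 2\<close> subject to \<open>a * b\<^sup>2 = exp 1\<close>, with \<open>b\<close> slightly enlarged.\<close>
  define a where "a = sqrt (2 * c / 5)"
  define b where "b = 4 * c / 5 + \<delta> / 2"
  have "c > 0" by (simp add: c)
  then have pos: "a > 0" "b > 0" using assms(2) by (auto simp: a_def b_def)
  have c5: "c ^ 5 = 3125 / 512 * (exp 1)\<^sup>2"
  proof -
    have "(2 powr (- 9 / 5)) ^ 5 = (2 :: real) powr (- 9)"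
      by (simp add: powr_power)
    moreover have "(exp 1 powr (2 / 5)) ^ 5 = (exp 1 :: real)\<^sup>2"
      by (simp add: powr_power)
    moreover have "(2 :: real) powr (- 9) = 1 / 512"
      using powr_minus_divide[of 2 "9 :: real"] by simp
    ultimately have "c ^ 5 = 5 ^ 5 * (1 / 512) * (exp 1)\<^sup>2"
      by (simp only: c power_mult_distrib)
    then show ?thesis by simp
  qed
  \<comment> \<open>Squaring removes the root in \<open>a\<close> and leaves \<open>c ^ 5\<close>,
    which has no fractional exponents.\<close>
  have "(a * (4 * c / 5)\<^sup>2)\<^sup>2 = 512 / 3125 * c ^ 5"
    using \<open>c > 0\<close> by (simp add: a_def power_mult_distrib power_divide eval_nat_numeral)
  also have "\<dots> = (exp 1)\<^sup>2" by (simp add: c5)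
  finally have "a * (4 * c / 5)\<^sup>2 = exp 1"
    using pos(1) by (subst (asm) power2_eq_iff_nonneg) auto
  moreover have "(4 * c / 5)\<^sup>2 < b\<^sup>2"
    using \<open>c > 0\<close> assms(2) by (intro power_strict_mono) (auto simp: b_def)
  ultimately have ab: "exp 1 < a * b\<^sup>2" using pos(1) by (metis mult_strict_left_mono)
  have "\<forall>\<^sub>F n in sequentially. 1 \<le> \<delta> / 2 * real n powr (2 / 5)"
    using assms(2) by real_asymp
  with eventually_criterion[OF pos ab] show ?thesis
    using eventually_gt_at_top[of 0]
  proof eventually_elim
    case (elim n)
    let ?x = "real n powr (1 / 5)"
    let ?s = "nat \<lceil>a * ?x\<rceil>" and ?q = "nat \<lceil>b * real n powr (2 / 5)\<rceil>"
    have x: "?x > 0" using elim by simp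
    have x2: "real n powr (2 / 5) = ?x\<^sup>2"
      using elim by (simp add: powr_power)
    have "0 < \<lceil>a * ?x\<rceil>" using x pos(1) by simp
    \<comment> \<open>Common neighbourhoods have at most \<open>s - 1\<close> vertices, and this
      \<open>- 1\<close> cancels the rounding up in \<open>?s\<close>.\<close>
    then have s: "real (?s - 1) \<le> a * ?x" "?s \<ge> 1" by linarith+
    have "real ((?s - 1) choose 2) \<le> (real (?s - 1))\<^sup>2 / 2"
      by (rule real_choose_2_le)
    also have "\<dots> \<le> (a * ?x)\<^sup>2 / 2"
      by (intro divide_right_mono power_mono s(1)) auto
    also have "\<dots> = c / 5 * ?x\<^sup>2"
      using \<open>c > 0\<close> by (simp add: a_def power_mult_distrib)
    finally have thr: "real ((?s - 1) choose 2) \<le> c / 5 * ?x\<^sup>2" .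
    have q: "real ?q \<le> b * ?x\<^sup>2 + 1"
      unfolding x2 using pos(2) by (simp add: of_nat_nat)
    have "threshold_bias n \<le> ?q + ((?s - 1) choose 2)"
      unfolding threshold_bias_def
      by (rule Least_le, rule winning_strategy_criterion) (use elim(1) in simp)
    then have "real (threshold_bias n) \<le> real ?q + real ((?s - 1) choose 2)"
      by (metis of_nat_add of_nat_le_iff)
    also have "\<dots> \<le> (c + \<delta>) * ?x\<^sup>2"
      using thr q elim(2) unfolding x2 by (simp add: b_def algebra_simps)
    finally show ?case unfolding x2 .
  qed
qed

theorem theorem1p8:
  "\<exists>\<epsilon> :: nat \<Rightarrow> real. \<epsilon> \<in> o(\<lambda>_. 1) \<and>
     (\<forall>\<^sub>F n in sequentially.
        real (threshold_bias n) \<le> (5 * 2 powr (- 9 / 5) * exp 1 powr (2 / 5) + \<epsilon> n) * real n powr (2 / 5))"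
proof -
  define c :: real where "c = 5 * 2 powr (- 9 / 5) * exp 1 powr (2 / 5)"
  \<comment> \<open>Truncation at 0 is essential: only an upper bound on the threshold is available,
    so the plain difference need not tend to 0.\<close>
  define \<epsilon> where "\<epsilon> = (\<lambda>n. max 0 (real (threshold_bias n) / real n powr (2 / 5) - c))"
  have "\<forall>\<^sub>F n in sequentially. norm (\<epsilon> n) \<le> \<delta> * norm (1 :: real)" if "\<delta> > 0" for \<delta>
    using eventually_threshold_bias_le[OF c_def that] eventually_gt_at_top[of 0]
  proof eventually_elim
    case (elim n)
    then have "real (threshold_bias n) / real n powr (2 / 5) \<le> c + \<delta>"
      by (simp add: field_simps)
    then show ?case using that by (simp add: \<epsilon>_def)
  qed
  then have "\<epsilon> \<in> o(\<lambda>_. 1)" by (rule landau_o.smallI)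
  moreover have "\<forall>\<^sub>F n in sequentially.
      real (threshold_bias n) \<le> (c + \<epsilon> n) * real n powr (2 / 5)"
    using eventually_gt_at_top[of 0]
  proof eventually_elim
    case (elim n)
    have "real (threshold_bias n) / real n powr (2 / 5) \<le> c + \<epsilon> n"
      unfolding \<epsilon>_def by linarith
    then show ?case using elim by (simp add: field_simps)
  qed
  ultimately show ?thesis unfolding c_def by blast
qed

end
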